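(* Let $P$ be a set of $n$ points in the plane in general position (no three collinear), and let $m$ be the size of a largest crossing family on $P$. Let $k \ge 3$ be an integer with $k \le m$. Then every partition of the complete geometric graph $K(P)$ into $k$-quasi-planar subgraphs consists of at least $\lceil \frac{m}{k-1} \rceil$ subgraphs, and there exists a partition of $K(P)$ into at most $\lceil \frac{m}{k-1} \rceil + \lceil \frac{n-2m}{k-1} \rceil$ $k$-quasi-planar subgraphs.
   Context: The complete geometric graph $K(P)$ has vertex set $P$ and all straight-line segments between points of $P$ as edges. Two segments cross if they share a point in their relative interiors. A crossing family on $P$ is a set of pairwise crossing segments with endpoints in $P$. A geometric graph is $k$-quasi-planar if it contains no $k$ pairwise crossing edges. A partition of a graph $G$ is a set of edge-disjoint subgraphs of $G$ whose union is $G$. *)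

theory Defs
  imports "HOL-Analysis.Analysis" "HOL-Library.Disjoint_Sets"
begin

definition general_position :: "(real^2) set \<Rightarrow> bool" where
  "general_position P \<longleftrightarrow> (\<forall>T\<subseteq>P. card T = 3 \<longrightarrow> \<not> collinear T)"

text \<open>An edge (straight-line segment) is represented by the two-element set of its endpoints;
  the segment itself is the convex hull of that set.\<close>

definition crosses :: "(real^2) set \<Rightarrow> (real^2) set \<Rightarrow> bool" where
  "crosses e f \<longleftrightarrow> rel_interior (convex hull e) \<inter> rel_interior (convex hull f) \<noteq> {}"

definition segments_on :: "(real^2) set \<Rightarrow> (real^2) set set" where
  "segments_on P = {e. e \<subseteq> P \<and> card e = 2}"

definition crossing_family :: "(real^2) set \<Rightarrow> (real^2) set set \<Rightarrow> bool" where
  "crossing_family P F \<longleftrightarrow> F \<subseteq> segments_on P \<and> pairwise crosses F"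

text \<open>For finite \<open>P\<close> the maximum ranges over a finite set, nonempty because the empty family
  is a crossing family.\<close>

definition max_crossing_family_size :: "(real^2) set \<Rightarrow> nat" where
  "max_crossing_family_size P = Max (card ` {F. crossing_family P F})"

record geom_graph =
  verts :: "(real^2) set"
  edges :: "(real^2) set set"

definition complete_geom_graph :: "(real^2) set \<Rightarrow> geom_graph" where
  "complete_geom_graph P = \<lparr>verts = P, edges = segments_on P\<rparr>"

definition subgraph_of :: "geom_graph \<Rightarrow> geom_graph \<Rightarrow> bool" where
  "subgraph_of H G \<longleftrightarrow>
     verts H \<subseteq> verts G \<and> edges H \<subseteq> edges G \<and> edges H \<subseteq> segments_on (verts H)"

definition quasi_planar :: "nat \<Rightarrow> geom_graph \<Rightarrow> bool" where
  "quasi_planar k G \<longleftrightarrow> \<not> (\<exists>F\<subseteq>edges G. card F = k \<and> pairwise crosses F)"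

text \<open>The subgraphs need only be edge-disjoint; they may share vertices. If \<open>G\<close> is finite,
  so is every partition of it, and \<open>card\<close> then counts the subgraphs.\<close>

definition graph_partition :: "geom_graph set \<Rightarrow> geom_graph \<Rightarrow> bool" where
  "graph_partition \<H> G \<longleftrightarrow>
     (\<forall>H\<in>\<H>. subgraph_of H G) \<and> disjoint_family_on edges \<H> \<and>
     \<Union> (verts ` \<H>) = verts G \<and> \<Union> (edges ` \<H>) = edges G"

end

theory Submission
  imports Defs
begin

text \<open>Lower bound: a \<open>k\<close>-quasi-planar subgraph contains at most \<open>k - 1\<close> edges of a largest
  crossing family \<open>F\<close>.

  Upper bound: two crossing segments share no endpoint, so \<open>F\<close> covers \<open>2m\<close> points. For
  \<open>e = {v, v'}\<close> in \<open>F\<close>, join \<open>v\<close> to the points to the left of the directed line \<open>v v'\<close> and \<open>v'\<close> to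
  the points to the left of \<open>v' v\<close>; together with \<open>e\<close> this is a plane double star, since the line
  separates its two halves. If \<open>v v'\<close> and \<open>w w'\<close> cross at \<open>p\<close>, then the triangles \<open>v p w\<close> and
  \<open>w p v\<close> have opposite orientations, so \<open>v w\<close> lies in one of the two double stars. Adding the stars
  at the \<open>n - 2m\<close> points that \<open>F\<close> misses, we have covered all edges by \<open>n - m\<close> plane graphs. The
  union of any \<open>k - 1\<close> plane graphs is \<open>k\<close>-quasi-planar by the pigeonhole principle.\<close>

section \<open>Orientation of point triples\<close>

text \<open>Twice the signed area of the triangle \<open>a b c\<close>, positive when
  \<open>c\<close> lies to the left of the directed line \<open>a b\<close>.\<close>

definition orient :: "real^2 \<Rightarrow> real^2 \<Rightarrow> real^2 \<Rightarrow> real" where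
  "orient a b c = (b$1 - a$1) * (c$2 - a$2) - (b$2 - a$2) * (c$1 - a$1)"

lemma orient_same [simp]: "orient a b a = 0" "orient a b b = 0" "orient a a b = 0"
  by (simp_all add: orient_def)

lemma orient_swap: "orient b a c = - orient a b c"
  by (simp add: orient_def algebra_simps)

lemma orient_cycle: "orient b c a = orient a b c"
  by (simp add: orient_def algebra_simps)

text \<open>\<open>orient\<close> is affine in its last argument; this relates its sign at a
  crossing point to its signs at the endpoints of a segment.\<close>

lemma orient_combination:
  "orient a b ((1 - u) *\<^sub>R c + u *\<^sub>R d) = (1 - u) * orient a b c + u * orient a b d"
  by (simp add: orient_def algebra_simps)

lemma orient_eq_0_imp_collinear:
  assumes "orient a b c = 0"
  shows "collinear {a, b, c}"
proof (cases "a = b")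
  case True
  then show ?thesis by simp
next
  case False
  have 0: "(b$1 - a$1) * (c$2 - a$2) = (b$2 - a$2) * (c$1 - a$1)"
    using assms by (simp add: orient_def)
  have "\<exists>t. c - a = t *\<^sub>R (b - a)"
  \<comment> \<open>The factor is read off from a coordinate in which \<open>a\<close> and
    \<open>b\<close> differ.\<close>
  proof (cases "b$1 = a$1")
    case True
    then have "b$2 \<noteq> a$2" using False by (simp add: vec_eq_iff forall_2)
    then have "c - a = ((c$2 - a$2) / (b$2 - a$2)) *\<^sub>R (b - a)"
      using 0 True by (auto simp: vec_eq_iff forall_2)
    then show ?thesis ..
  next
    case False
    then have "c$2 - a$2 = (c$1 - a$1) / (b$1 - a$1) * (b$2 - a$2)"
      using 0 by (simp add: eq_divide_eq mult.commute)
    with False have "c - a = ((c$1 - a$1) / (b$1 - a$1)) *\<^sub>R (b - a)"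
      by (simp add: vec_eq_iff forall_2)
    then show ?thesis ..
  qed
  then have "collinear {0, b - a, c - a}"
    by (auto simp: collinear_lemma)
  then have "collinear {b, a, c}"
    by (subst collinear_3) auto
  then show ?thesis
    by (simp add: insert_commute)
qed

lemma general_position_orient:
  assumes "general_position P" "a \<in> P" "b \<in> P" "c \<in> P" "a \<noteq> b" "a \<noteq> c" "b \<noteq> c"
  shows "orient a b c \<noteq> 0"
proof
  assume "orient a b c = 0"
  then have "collinear {a, b, c}" by (rule orient_eq_0_imp_collinear)
  moreover have "card {a, b, c} = 3" "{a, b, c} \<subseteq> P" using assms by auto
  ultimately show False using assms(1) unfolding general_position_def by blast
qed

section \<open>Crossing segments\<close>

lemma crossesE:
  assumes "crosses {a, b} {c, d}" "a \<noteq> b" "c \<noteq> d"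
  obtains p s t where "0 < s" "s < 1" "0 < t" "t < 1"
    "p = (1 - s) *\<^sub>R a + s *\<^sub>R b" "p = (1 - t) *\<^sub>R c + t *\<^sub>R d"
proof -
  have "open_segment a b \<inter> open_segment c d \<noteq> {}"
    using assms by (simp add: crosses_def rel_interior_closed_segment flip: segment_convex_hull)
  then obtain p where "p \<in> open_segment a b" "p \<in> open_segment c d" by auto
  then show thesis
    using that[of _ _ p] by (auto simp: in_segment)
qed

lemma segments_onE:
  assumes "e \<in> segments_on P" "v \<in> e"
  obtains w where "e = {v, w}" "v \<noteq> w" "v \<in> P" "w \<in> P"
proof -
  obtain x y where "e = {x, y}" "x \<noteq> y"
    using assms(1) by (auto simp: segments_on_def card_2_iff)
  then show thesis
    using assms that unfolding segments_on_def by blast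
qed

lemma finite_segments_on: "finite P \<Longrightarrow> finite (segments_on P)"
  by (simp add: segments_on_def)

lemma crosses_imp_disjoint:
  assumes gp: "general_position P" and e: "e \<in> segments_on P" and f: "f \<in> segments_on P"
    and "e \<noteq> f" "crosses e f"
  shows "e \<inter> f = {}"
proof (rule ccontr)
  assume "e \<inter> f \<noteq> {}"
  then obtain v where "v \<in> e" "v \<in> f" by auto
  from segments_onE[OF e \<open>v \<in> e\<close>] obtain w where w: "e = {v, w}" "v \<noteq> w" "v \<in> P" "w \<in> P" .
  from segments_onE[OF f \<open>v \<in> f\<close>] obtain x where x: "f = {v, x}" "v \<noteq> x" "x \<in> P" .
  from \<open>crosses e f\<close> w x obtain p s t where p: "0 < t"
    "p = (1 - s) *\<^sub>R v + s *\<^sub>R w" "p = (1 - t) *\<^sub>R v + t *\<^sub>R x"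
    by (metis crossesE)
  \<comment> \<open>The crossing point \<open>p\<close> lies on both lines through the shared
    endpoint \<open>v\<close>, which would make \<open>v\<close>, \<open>w\<close>, \<open>x\<close>
    collinear.\<close>
  have "t * orient v w x = orient v w p" by (simp only: p(3) orient_combination) simp
  also have "\<dots> = 0" by (simp only: p(2) orient_combination) simp
  finally show False
    using p(1) general_position_orient[OF gp, of v w x] w x \<open>e \<noteq> f\<close> by auto
qed

text \<open>The line \<open>v v'\<close> separates the segments: the interior of one lies strictly
  to its left, that of the other strictly to its right.\<close>

lemma not_crosses_opposite_sides:
  assumes "orient v v' w > 0" "orient v' v x > 0"
  shows "\<not> crosses {v, w} {v', x}"
proof
  assume "crosses {v, w} {v', x}"
  moreover have "v \<noteq> w" "v' \<noteq> x" using assms by auto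
  ultimately obtain p s t where p: "0 < s" "0 < t"
    "p = (1 - s) *\<^sub>R v + s *\<^sub>R w" "p = (1 - t) *\<^sub>R v' + t *\<^sub>R x"
    by (metis crossesE)
  have "orient v v' p = s * orient v v' w" by (simp only: p(3) orient_combination) simp
  moreover have "orient v' v p = t * orient v' v x" by (simp only: p(4) orient_combination) simp
  moreover have "0 < s * orient v v' w" "0 < t * orient v' v x" using p assms by auto
  ultimately show False using orient_swap[of v' v p] by linarith
qed

lemma crosses_imp_left:
  assumes gp: "general_position P" and "{v, v', w, w'} \<subseteq> P" "v \<noteq> v'" "w \<noteq> w'"
    and "crosses {v, v'} {w, w'}" and "{v, v'} \<inter> {w, w'} = {}"
  shows "orient v v' w > 0 \<or> orient w w' v > 0"
proof (rule ccontr)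
  assume "\<not> ?thesis"
  moreover have "orient v v' w \<noteq> 0" "orient w w' v \<noteq> 0"
    using assms by (intro general_position_orient[OF gp]; auto)+
  ultimately have neg: "orient v v' w < 0" "orient w w' v < 0" by auto
  obtain p s t where p: "0 < s" "0 < t"
    "p = (1 - s) *\<^sub>R v + s *\<^sub>R v'" "p = (1 - t) *\<^sub>R w + t *\<^sub>R w'"
    using crossesE[OF assms(5,3,4)] by metis
  \<comment> \<open>\<open>p\<close> lies on the rays from \<open>v\<close> to \<open>v'\<close> and
    from \<open>w\<close> to \<open>w'\<close>, so \<open>orient w v p\<close> and
    \<open>orient v w p\<close> inherit the signs in \<open>neg\<close>; but they sum to
    zero.\<close>
  have "orient w v p = s * orient w v v'" by (simp only: p(3) orient_combination) simp
  also have "orient w v v' = orient v v' w" by (simp add: orient_cycle)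
  finally have 1: "orient w v p < 0" using neg p by (simp add: mult_pos_neg)
  have "orient v w p = t * orient v w w'" by (simp only: p(4) orient_combination) simp
  also have "orient v w w' = orient w w' v" by (simp add: orient_cycle)
  finally have 2: "orient v w p < 0" using neg p by (simp add: mult_pos_neg)
  show False using 1 2 orient_swap[of v w p] by linarith
qed

section \<open>Plane stars and double stars\<close>

definition plane :: "(real^2) set set \<Rightarrow> bool" where
  "plane E \<longleftrightarrow> (\<forall>e\<in>E. \<forall>f\<in>E. e \<noteq> f \<longrightarrow> \<not> crosses e f)"

definition star :: "(real^2) set \<Rightarrow> real^2 \<Rightarrow> (real^2) set set" where
  "star P v = {e \<in> segments_on P. v \<in> e}"

text \<open>The equation \<open>e = {v, v'}\<close> matches in both orders, so one comprehension
  yields the halves at both endpoints.\<close>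

definition double_star :: "(real^2) set \<Rightarrow> (real^2) set \<Rightarrow> (real^2) set set" where
  "double_star P e = insert e {{v, w} | v v' w. e = {v, v'} \<and> w \<in> P \<and> orient v v' w > 0}"

lemma plane_star:
  assumes "general_position P"
  shows "plane (star P v)"
  unfolding plane_def star_def using crosses_imp_disjoint[OF assms] by blast

lemma double_star_subset:
  assumes "e \<in> segments_on P"
  shows "double_star P e \<subseteq> segments_on P"
proof
  fix f assume "f \<in> double_star P e"
  then consider "f = e"
    | v v' w where "f = {v, w}" "e = {v, v'}" "w \<in> P" "orient v v' w > 0"
    unfolding double_star_def by blast
  then show "f \<in> segments_on P"
  proof cases
    case 2
    then have "v \<noteq> w" by auto
    with 2 assms show ?thesis by (auto simp: segments_on_def)
  qed (use assms in simp)
qed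

lemma plane_double_star:
  assumes gp: "general_position P" and e: "e \<in> segments_on P"
  shows "plane (double_star P e)"
  unfolding plane_def
proof (intro ballI impI notI)
  fix f g
  assume f: "f \<in> double_star P e" and g: "g \<in> double_star P e" and "f \<noteq> g" and c: "crosses f g"
  have "f \<in> segments_on P" "g \<in> segments_on P"
    using f g double_star_subset[OF e] by auto
  then have disj: "f \<inter> g = {}"
    using crosses_imp_disjoint gp \<open>f \<noteq> g\<close> c by blast
  \<comment> \<open>Every edge of the double star contains an endpoint of \<open>e\<close>, so
    neither edge of a disjoint pair is \<open>e\<close>.\<close>
  moreover have "h \<inter> e \<noteq> {}" if "h \<in> double_star P e" for h
    using that e by (auto simp: double_star_def segments_on_def)
  ultimately have "f \<noteq> e" "g \<noteq> e" using f g by blast+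
  then obtain v v' w u u' x where
    f': "f = {v, w}" "e = {v, v'}" "orient v v' w > 0" and
    g': "g = {u, x}" "e = {u, u'}" "orient u u' x > 0"
    using f g unfolding double_star_def by blast
  \<comment> \<open>Disjoint edges have different centres, hence lie on opposite sides of
    \<open>e\<close>.\<close>
  have "u = v'" "u' = v" using disj f' g' by (auto simp: doubleton_eq_iff)
  then show False using not_crosses_opposite_sides[of v v' w x] f' g' c by auto
qed

text \<open>An endpoint missed by \<open>F\<close> puts \<open>e\<close> into a star. If both
  endpoints lie on one member of \<open>F\<close>, then \<open>e\<close> is that member; if they lie
  on two, these cross and \<open>crosses_imp_left\<close> applies.\<close>

lemma crossing_family_covers:
  assumes gp: "general_position P" and F: "crossing_family P F" and e: "e \<in> segments_on P"
  shows "\<exists>E \<in> double_star P ` F \<union> star P ` (P - \<Union>F). e \<in> E"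
proof (cases "e \<subseteq> \<Union>F")
  case False
  then have "\<exists>v \<in> P - \<Union>F. e \<in> star P v"
    using e by (auto simp: star_def segments_on_def)
  then show ?thesis by blast
next
  case True
  obtain v w where vw: "e = {v, w}" "v \<noteq> w"
    using e by (auto simp: segments_on_def card_2_iff)
  with True obtain f g where fg: "f \<in> F" "v \<in> f" "g \<in> F" "w \<in> g" by auto
  have seg: "f \<in> segments_on P" "g \<in> segments_on P"
    using F fg by (auto simp: crossing_family_def)
  obtain v' where v': "f = {v, v'}" "v \<noteq> v'" "v \<in> P" "v' \<in> P"
    using segments_onE[OF seg(1) fg(2)] by metis
  obtain w' where w': "g = {w, w'}" "w \<noteq> w'" "w \<in> P" "w' \<in> P"
    using segments_onE[OF seg(2) fg(4)] by metis
  show ?thesis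
  proof (cases "f = g")
    case True
    then have "e = f" using vw v' w' by auto
    then have "e \<in> double_star P f" by (simp add: double_star_def)
    then show ?thesis using fg by blast
  next
    case False
    then have "crosses f g"
      using F fg by (auto simp: crossing_family_def pairwise_def)
    with False have "f \<inter> g = {}" using crosses_imp_disjoint[OF gp seg] by blast
    then have "orient v v' w > 0 \<or> orient w w' v > 0"
      using crosses_imp_left[OF gp] \<open>crosses f g\<close> v' w' by auto
    then have "e \<in> double_star P f \<or> e \<in> double_star P g"
      unfolding double_star_def using vw v' w' by blast
    then show ?thesis using fg by blast
  qed
qed

section \<open>Counting in crossing families and partitions\<close>

lemma crossing_family_finite: "finite P \<Longrightarrow> crossing_family P F \<Longrightarrow> finite F"
  unfolding crossing_family_def using finite_segments_on finite_subset by blast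

text \<open>General position makes crossing edges disjoint, so each contributes two new
  points.\<close>

lemma crossing_family_card_Union:
  assumes "finite P" "general_position P" "crossing_family P F"
  shows "card (\<Union>F) = 2 * card F"
proof -
  have F: "F \<subseteq> segments_on P" "pairwise crosses F"
    using assms(3) by (auto simp: crossing_family_def)
  have "pairwise disjnt F"
    using F crosses_imp_disjoint[OF assms(2)] unfolding pairwise_def disjnt_def by blast
  moreover have "finite e" if "e \<in> F" for e
    using that F(1) by (auto simp: segments_on_def intro!: card_ge_0_finite)
  ultimately have "card (\<Union>F) = sum card F"
    by (rule card_Union_disjoint)
  also have "\<dots> = sum (\<lambda>e. 2) F"
    by (rule sum.cong) (use F(1) in \<open>auto simp: segments_on_def\<close>)
  finally show ?thesis by simp
qed

lemma max_crossing_family_exists: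
  assumes "finite P"
  obtains F where "crossing_family P F" "card F = max_crossing_family_size P"
proof -
  have "{F. crossing_family P F} \<subseteq> Pow (segments_on P)"
    by (auto simp: crossing_family_def)
  then have "finite {F. crossing_family P F}"
    using finite_segments_on[OF assms] by (meson finite_Pow_iff finite_subset)
  moreover have "crossing_family P {}" by (simp add: crossing_family_def)
  ultimately have "max_crossing_family_size P \<in> card ` {F. crossing_family P F}"
    unfolding max_crossing_family_size_def by (intro Max_in) auto
  then show thesis using that by auto
qed

text \<open>Rules out the default \<open>card \<H> = 0\<close> of an infinite set. A graph is
  determined by its vertex and edge sets, which range over finite power sets.\<close>

lemma graph_partition_finite:
  assumes "finite P" "graph_partition \<H> (complete_geom_graph P)"
  shows "finite \<H>"
proof -
  have "(\<lambda>H. (verts H, edges H)) ` \<H> \<subseteq> Pow P \<times> Pow (segments_on P)"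
    using assms(2) by (auto simp: graph_partition_def subgraph_of_def complete_geom_graph_def)
  then have "finite ((\<lambda>H. (verts H, edges H)) ` \<H>)"
    by (rule finite_subset) (use assms finite_segments_on in auto)
  then show ?thesis
    by (rule finite_imageD) (auto simp: inj_on_def)
qed

lemma crossing_family_card_le_partition:
  assumes "finite P" and F: "crossing_family P F" and "0 < k"
    and H: "graph_partition \<H> (complete_geom_graph P)"
    and q: "\<And>H. H \<in> \<H> \<Longrightarrow> quasi_planar k H"
  shows "card F \<le> card \<H> * (k - 1)"
proof -
  have "F \<subseteq> (\<Union>H\<in>\<H>. edges H)"
    using F H by (auto simp: crossing_family_def graph_partition_def complete_geom_graph_def)
  then have "F = (\<Union>H\<in>\<H>. F \<inter> edges H)" by auto
  then have "card F \<le> (\<Sum>H\<in>\<H>. card (F \<inter> edges H))"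
    using card_UN_le[OF graph_partition_finite[OF assms(1) H], of "\<lambda>H. F \<inter> edges H"] by simp
  also have "\<dots> \<le> card \<H> * (k - 1)"
  proof -
    have "card (F \<inter> edges H) \<le> k - 1" if "H \<in> \<H>" for H
    proof (rule ccontr)
      assume "\<not> ?thesis"
      \<comment> \<open>\<open>quasi_planar\<close> speaks of exactly \<open>k\<close> edges, so a
        subfamily of that size is selected.\<close>
      then obtain G where "G \<subseteq> F \<inter> edges H" "card G = k"
        by (metis obtain_subset_with_card_n not_le_imp_less Suc_leI Suc_pred' \<open>0 < k\<close>)
      moreover have "pairwise crosses F" using F by (simp add: crossing_family_def)
      ultimately show False
        using q[OF that] unfolding quasi_planar_def by (metis le_inf_iff pairwise_subset)
    qed
    then show ?thesis using sum_bounded_above[of \<H> "\<lambda>H. card (F \<inter> edges H)" "k - 1"] by simp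
  qed
  finally show ?thesis .
qed

section \<open>Bundling plane graphs into quasi-planar ones\<close>

text \<open>The plane graphs are numbered from 0 and cut into blocks of \<open>k - 1\<close>
  consecutive numbers; each block yields one subgraph.\<close>

lemma partition_of_plane_cover:
  assumes "finite \<T>" and plane: "\<And>E. E \<in> \<T> \<Longrightarrow> plane E"
    and cover: "\<And>e. e \<in> segments_on P \<Longrightarrow> \<exists>E\<in>\<T>. e \<in> E"
    and "\<T> \<noteq> {}" "2 \<le> k"
  shows "\<exists>\<H>. graph_partition \<H> (complete_geom_graph P) \<and> (\<forall>H\<in>\<H>. quasi_planar k H) \<and>
    int (card \<H>) \<le> \<lceil>real (card \<T>) / (real k - 1)\<rceil>"
proof -
  define d where "d = k - 1"
  have d: "0 < d" "k = Suc d" using assms by (auto simp: d_def)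
  obtain h where h: "bij_betw h \<T> {0..<card \<T>}"
    using ex_bij_betw_finite_nat[OF assms(1)] by blast
  \<comment> \<open>The members of the cover may overlap; choosing one for each edge makes the
    classes disjoint.\<close>
  define cls where "cls e = (SOME E. E \<in> \<T> \<and> e \<in> E)" for e
  have cls: "cls e \<in> \<T>" "e \<in> cls e" if "e \<in> segments_on P" for e
    using someI_ex[of "\<lambda>E. E \<in> \<T> \<and> e \<in> E"] cover[OF that] unfolding cls_def by blast+
  define N where "N = nat \<lceil>real (card \<T>) / real d\<rceil>"
  have less_N: "h E div d < N" if "E \<in> \<T>" for E
  proof -
    have "h E < card \<T>" using h that by (auto dest: bij_betwE)
    have "real (h E div d) \<le> real (h E) / real d"
      using floor_divide_of_nat_eq[where ?'a = real, of "h E" d] by linarith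
    also have "\<dots> < real (card \<T>) / real d"
      using \<open>h E < card \<T>\<close> d by (simp add: divide_strict_right_mono)
    finally show ?thesis unfolding N_def by linarith
  qed
  define G where "G i = \<lparr>verts = P, edges = {e \<in> segments_on P. h (cls e) div d = i}\<rparr>" for i
  \<comment> \<open>At least one class must exist for the vertex sets to have union
    \<open>P\<close>.\<close>
  have "N > 0" using less_N \<open>\<T> \<noteq> {}\<close> by force
  have "graph_partition (G ` {..<N}) (complete_geom_graph P)"
    using less_N cls(1) \<open>N > 0\<close>
    by (auto simp: graph_partition_def complete_geom_graph_def G_def subgraph_of_def
        disjoint_family_on_def)
  moreover have "quasi_planar k (G i)" for i
    unfolding quasi_planar_def
  proof (intro notI, elim exE conjE)
    fix F assume F: "F \<subseteq> edges (G i)" "card F = k" "pairwise crosses F"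
    have F': "e \<in> segments_on P" "h (cls e) div d = i" if "e \<in> F" for e
      using that F(1) by (auto simp: G_def)
    \<comment> \<open>A block has only \<open>d = k - 1\<close> numbers, so two of the
      \<open>k\<close> edges share a plane graph and cannot cross.\<close>
    have "h (cls e) \<in> {i * d..<i * d + d}" if "e \<in> F" for e
      using F'(2)[OF that] d(1) by (auto simp: dividend_less_div_times add.commute)
    then have "(\<lambda>e. h (cls e)) ` F \<subseteq> {i * d..<i * d + d}" by blast
    then have "card ((\<lambda>e. h (cls e)) ` F) \<le> card {i * d..<i * d + d}"
      by (intro card_mono) auto
    then have "card ((\<lambda>e. h (cls e)) ` F) < card F" using F(2) d by simp
    then have "\<not> inj_on (\<lambda>e. h (cls e)) F" by (rule pigeonhole)
    then obtain e f where ef: "e \<in> F" "f \<in> F" "e \<noteq> f" "h (cls e) = h (cls f)"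
      by (auto simp: inj_on_def)
    have "cls e = cls f"
      using ef cls(1) F'(1) h by (metis bij_betw_imp_inj_on inj_onD)
    then have "\<not> crosses e f"
      using plane[of "cls e"] cls F'(1) ef unfolding plane_def by metis
    then show False using F(3) ef by (auto simp: pairwise_def)
  qed
  moreover have "int (card (G ` {..<N})) \<le> \<lceil>real (card \<T>) / (real k - 1)\<rceil>"
  proof -
    \<comment> \<open>Only an inequality: classes without edges coincide as graphs.\<close>
    have "card (G ` {..<N}) \<le> N" using card_image_le[of "{..<N}" G] by simp
    moreover have "int N = \<lceil>real (card \<T>) / (real k - 1)\<rceil>"
    proof -
      have "0 \<le> real (card \<T>) / real d" by simp
      then have "int N = \<lceil>real (card \<T>) / real d\<rceil>" unfolding N_def by linarith
      then show ?thesis using d by simp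
    qed
    ultimately show ?thesis by simp
  qed
  ultimately show ?thesis by blast
qed

theorem theorem4:
  fixes P :: "(real^2) set" and n m k :: nat
  assumes "finite P"
    and "card P = n"
    and "general_position P"
    and "m = max_crossing_family_size P"
    and "3 \<le> k"
    and "k \<le> m"
  shows "(\<forall>\<H>. graph_partition \<H> (complete_geom_graph P) \<and> (\<forall>H\<in>\<H>. quasi_planar k H)
            \<longrightarrow> \<lceil>real m / (real k - 1)\<rceil> \<le> int (card \<H>)) \<and>
         (\<exists>\<H>. graph_partition \<H> (complete_geom_graph P) \<and> (\<forall>H\<in>\<H>. quasi_planar k H) \<and>
            int (card \<H>) \<le> \<lceil>real m / (real k - 1)\<rceil> + \<lceil>(real n - 2 * real m) / (real k - 1)\<rceil>)"
proof
  obtain F where F: "crossing_family P F" and card_F: "card F = m"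
    using max_crossing_family_exists[OF assms(1)] assms(4) by metis
  have finite_F: "finite F" using crossing_family_finite[OF assms(1) F] .
  show "\<forall>\<H>. graph_partition \<H> (complete_geom_graph P) \<and> (\<forall>H\<in>\<H>. quasi_planar k H)
            \<longrightarrow> \<lceil>real m / (real k - 1)\<rceil> \<le> int (card \<H>)"
  proof (intro allI impI, elim conjE)
    fix \<H> assume "graph_partition \<H> (complete_geom_graph P)" "\<forall>H\<in>\<H>. quasi_planar k H"
    then have "m \<le> card \<H> * (k - 1)"
      using crossing_family_card_le_partition[OF assms(1) F, of k \<H>] card_F assms(5) by simp
    then have "real m \<le> real (card \<H> * (k - 1))" by (rule of_nat_mono)
    then have "real m \<le> real (card \<H>) * (real k - 1)" using assms(5) by (simp add: of_nat_diff)
    then have "real m / (real k - 1) \<le> real (card \<H>)" using assms(5) by (simp add: divide_le_eq)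
    then show "\<lceil>real m / (real k - 1)\<rceil> \<le> int (card \<H>)" by (simp add: ceiling_le_iff)
  qed
  define \<T> where "\<T> = double_star P ` F \<union> star P ` (P - \<Union>F)"
  have "\<Union>F \<subseteq> P" using F by (auto simp: crossing_family_def segments_on_def)
  have card_UF: "card (\<Union>F) = 2 * m"
    using crossing_family_card_Union[OF assms(1,3) F] card_F by simp
  have "2 * m \<le> n"
    using card_mono[OF assms(1) \<open>\<Union>F \<subseteq> P\<close>] card_UF assms(2) by simp
  have "card (P - \<Union>F) = n - 2 * m"
    using card_Diff_subset[of "\<Union>F" P] \<open>\<Union>F \<subseteq> P\<close> assms(1,2) card_UF finite_subset by metis
  then have "card \<T> \<le> m + (n - 2 * m)"
    unfolding \<T>_def using card_Un_le[of "double_star P ` F" "star P ` (P - \<Union>F)"]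
      card_image_le[OF finite_F, of "double_star P"]
      card_image_le[of "P - \<Union>F" "star P"] assms(1) card_F by simp
  \<comment> \<open>Since \<open>2 * m \<le> n\<close>, the truncated difference agrees with the
    real one.\<close>
  then have "real (card \<T>) \<le> real m + (real n - 2 * real m)"
    using \<open>2 * m \<le> n\<close> by linarith
  then have "real (card \<T>) / (real k - 1) \<le>
      real m / (real k - 1) + (real n - 2 * real m) / (real k - 1)"
    using assms(5) by (simp add: divide_right_mono flip: add_divide_distrib)
  \<comment> \<open>The ceiling is monotone and subadditive.\<close>
  then have bound: "\<lceil>real (card \<T>) / (real k - 1)\<rceil> \<le>
      \<lceil>real m / (real k - 1)\<rceil> + \<lceil>(real n - 2 * real m) / (real k - 1)\<rceil>"
    by linarith
  have "finite \<T>" using assms(1) finite_F by (simp add: \<T>_def)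
  moreover have "plane E" if "E \<in> \<T>" for E
    using that plane_star[OF assms(3)] plane_double_star[OF assms(3)] F
    by (auto simp: \<T>_def crossing_family_def)
  moreover have "\<exists>E\<in>\<T>. e \<in> E" if "e \<in> segments_on P" for e
    using crossing_family_covers[OF assms(3) F that] by (simp add: \<T>_def)
  moreover have "\<T> \<noteq> {}" using assms(5,6) card_F by (auto simp: \<T>_def)
  ultimately obtain \<H> where "graph_partition \<H> (complete_geom_graph P)"
    "\<forall>H\<in>\<H>. quasi_planar k H" "int (card \<H>) \<le> \<lceil>real (card \<T>) / (real k - 1)\<rceil>"
    using partition_of_plane_cover[of \<T> P k] assms(5) by auto
  with bound show "\<exists>\<H>. graph_partition \<H> (complete_geom_graph P) \<and> (\<forall>H\<in>\<H>. quasi_planar k H) \<and>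
      int (card \<H>) \<le> \<lceil>real m / (real k - 1)\<rceil> + \<lceil>(real n - 2 * real m) / (real k - 1)\<rceil>"
    by (meson order_trans)
qed

end
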